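(* Let $M\ge1$, $N\ge 2$, $1\le m\le M$, and $\sigma_x^2,\sigma_n^2>0$. Among tight fusion frames $\{\mathcal{W}_i\}_{i=1}^N$ for $\mathbb{R}^M$ consisting of $m$-dimensional subspaces, the MSE due to two subspace erasures is minimized when the subspaces are maximal equi-distance subspaces. That is, if $\{\mathcal{W}_i^\ast\}_{i=1}^N$ is an equi-distance tight fusion frame for $\mathbb{R}^M$ of $m$-dimensional subspaces, then for every tight fusion frame $\{\mathcal{W}_i\}_{i=1}^N$ for $\mathbb{R}^M$ of $m$-dimensional subspaces, the value $\max_{i\ne j}MSE_{\{i,j\}}$ for $\{\mathcal{W}_i^\ast\}$ is at most the value $\max_{i\neq j}MSE_{\{i,j\}}$ for $\{\mathcal{W}_i\}$.
   Context: A tight fusion frame for $\mathbb{R}^M$ is a finite collection of subspaces $\{\mathcal{W}_i\}_{i=1}^N$ of $\mathbb{R}^M$ whose orthogonal projections $\mathbf{P}_i$ satisfy $\sum_{i=1}^N\mathbf{P}_i=A\,\mathbf{I}$ for some $A>0$. The chordal distance between two $m$-dimensional subspaces $\mathcal{W}_i,\mathcal{W}_j$ with principal angles $\theta_1(i,j),\dots,\theta_m(i,j)$ is $d_c(i,j)=\big(\sum_{\ell=1}^m\sin^2\theta_\ell(i,j)\big)^{1/2}$; equivalently $d_c^2(i,j)=m-\mathrm{tr}[\mathbf{P}_i\mathbf{P}_j]$. An equi-distance tight fusion frame is a tight fusion frame whose subspaces all have the same dimension and all have equal pairwise chordal distances $d_c(i,j)$, $i\ne j$; its subspaces are called maximal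 equi-distance subspaces. Measurement model: $\mathbf{x}$ is a zero-mean random vector in $\mathbb{R}^M$ with $\mathbf{R}_{xx}=E[\mathbf{x}\mathbf{x}^T]=\sigma_x^2\mathbf{I}$; $\mathbf{z}_i=\mathbf{P}_i\mathbf{x}+\mathbf{n}_i$, $i=1,\dots,N$, where the noise vectors $\mathbf{n}_i$ are mutually uncorrelated, uncorrelated with $\mathbf{x}$, and $E[\mathbf{n}_i\mathbf{n}_i^T]=\sigma_n^2\mathbf{I}$. Put $\mathbf{z}=(\mathbf{z}_1^T,\dots,\mathbf{z}_N^T)^T\in\mathbb{R}^{NM}$. The (no-erasure) LMMSE filter is $\mathbf{F}=\mathbf{R}_{xz}\mathbf{R}_{zz}^{-1}$, with $\mathbf{R}_{xz}=E[\mathbf{x}\mathbf{z}^T]$ and $\mathbf{R}_{zz}=E[\mathbf{z}\mathbf{z}^T]$. Erasures: for a set $\mathbb{S}\subset\{1,\dots,N\}$ of erased indices, let $\mathbf{E}$ be the $NM\times NM$ block-diagonal matrix whose $i$th $M\times M$ diagonal block is $\mathbf{I}$ if $i\in\mathbb{S}$ and $\mathbf{0}$ otherwise. The signal is estimated by $\tilde{\mathbf{x}}=\mathbf{F}(\mathbf{I}-\mathbf{E})\mathbf{z}$ (the filter $\mathbf{F}$ is not recomputed), and the MSE under erasure of $\mathbb{S}$ is $MSE_{\mathbb{S}}=\mathrm{tr}\,E[(\mathbf{x}-\tilde{\mathbf{x}})(\mathbf{x}-\tilde{\mathbf{x}})^T]$. Since any pair of subspaces may be erased, the MSE due to two erasures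 is understood as the largest value over the choice of the erased pair. *)

theory Defs
  imports "HOL-Probability.Probability"
begin

section \<open>Fusion frames\<close>

definition proj_matrix :: "(real^'m) set \<Rightarrow> real^'m^'m" where
  "proj_matrix U = (THE P. \<forall>v. P *v v \<in> U \<and> (\<forall>u\<in>U. orthogonal (v - P *v v) u))"

lemma proj_matrix_unique_existence:
  fixes U :: "(real^'m) set"
  assumes "subspace U"
  shows "\<exists>!P::real^'m^'m. \<forall>v. P *v v \<in> U \<and> (\<forall>u\<in>U. orthogonal (v - P *v v) u)"
proof -
  let ?good = "\<lambda>v p. p \<in> U \<and> (\<forall>u\<in>U. orthogonal (v - p) u)"
  have uniq: "p = q" if "?good v p" "?good v q" for v p q
  proof -
    have "p - q \<in> U" using that assms by (simp add: subspace_diff)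
    then have "(v - q) \<bullet> (p - q) = 0" "(v - p) \<bullet> (p - q) = 0"
      using that by (auto simp: orthogonal_def)
    then have "(p - q) \<bullet> (p - q) = 0" by (simp add: inner_diff)
    then show ?thesis by simp
  qed
  have "\<exists>p. ?good v p" for v
  proof -
    have "span U = U" using assms by (simp add: span_eq_iff)
    then obtain y z where "y \<in> U" "\<And>w. w \<in> U \<Longrightarrow> orthogonal z w" "v = y + z"
      using orthogonal_subspace_decomp_exists[of U v] by metis
    then have "?good v y" by simp
    then show ?thesis ..
  qed
  then have "\<exists>f. \<forall>v. ?good v (f v)" by (rule choice[OF allI])
  then obtain f where f: "\<And>v. ?good v (f v)" by blast
  have "linear f"
  proof (rule linearI)
    fix a b show "f (a + b) = f a + f b"
    proof (rule uniq[of _ "a + b"])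
      have "f a + f b \<in> U" using f assms by (simp add: subspace_add)
      moreover have "(a + b - (f a + f b)) \<bullet> u = (a - f a) \<bullet> u + (b - f b) \<bullet> u" for u
        by (simp add: inner_diff_left inner_add_left)
      ultimately show "?good (a + b) (f a + f b)"
        using f by (simp add: orthogonal_def)
    qed (rule f)
  next
    fix c b show "f (c *\<^sub>R b) = c *\<^sub>R f b"
    proof (rule uniq[of _ "c *\<^sub>R b"])
      have "c *\<^sub>R f b \<in> U" using f assms by (simp add: subspace_scale)
      moreover have "(c *\<^sub>R b - c *\<^sub>R f b) \<bullet> u = c * ((b - f b) \<bullet> u)" for u
        by (simp add: inner_diff_left right_diff_distrib)
      ultimately show "?good (c *\<^sub>R b) (c *\<^sub>R f b)"
        using f by (simp add: orthogonal_def)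
    qed (rule f)
  qed
  then have mf: "matrix f *v v = f v" for v
    by (rule fun_cong[OF matrix_vector_mul(2)])
  show ?thesis
  proof (rule ex1I[of _ "matrix f"])
    show "\<forall>v. ?good v (matrix f *v v)" using f mf by simp
  next
    fix P :: "real^'m^'m" assume "\<forall>v. ?good v (P *v v)"
    then have "P *v v = f v" for v
      by (intro uniq[of _ v] f) (rule spec)
    then have "P *v v = matrix f *v v" for v
      using mf by simp
    then show "P = matrix f" unfolding matrix_eq by blast
  qed
qed

definition tight_fusion_frame :: "('n::finite \<Rightarrow> (real^'m) set) \<Rightarrow> bool" where
  "tight_fusion_frame W \<longleftrightarrow>
     (\<forall>i. subspace (W i)) \<and> (\<exists>A>0. (\<Sum>i\<in>UNIV. proj_matrix (W i)) = A *\<^sub>R mat 1)"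

text \<open>
  The principal angles of subspaces U, V of equal dimension, indexed from 0. They are given by
  principal vectors: the l-th pair (a l, b l) attains the minimal angle among all pairs of unit
  vectors of U and V that are orthogonal to the earlier principal vectors of U and of V,
  respectively.
\<close>

definition principal_angles ::
    "(real^'m) set \<Rightarrow> (real^'m) set \<Rightarrow> (nat \<Rightarrow> real) \<Rightarrow> bool" where
  "principal_angles U V \<theta> \<longleftrightarrow>
     (\<exists>a b :: nat \<Rightarrow> real^'m. \<forall>l<dim U.
        (let X = {u \<in> U. norm u = 1 \<and> (\<forall>k<l. orthogonal (a k) u)};
             Y = {v \<in> V. norm v = 1 \<and> (\<forall>k<l. orthogonal (b k) v)}
         in a l \<in> X \<and> b l \<in> Y \<and> \<theta> l = arccos (a l \<bullet> b l) \<and>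
            (\<forall>u\<in>X. \<forall>v\<in>Y. \<theta> l \<le> arccos (u \<bullet> v))))"

definition chordal_dist :: "(real^'m) set \<Rightarrow> (real^'m) set \<Rightarrow> real" where
  "chordal_dist U V =
     (THE d. \<exists>\<theta>. principal_angles U V \<theta> \<and> d = sqrt (\<Sum>l<dim U. (sin (\<theta> l))\<^sup>2))"

definition equidistance_tight_fusion_frame :: "('n::finite \<Rightarrow> (real^'m) set) \<Rightarrow> bool" where
  "equidistance_tight_fusion_frame W \<longleftrightarrow>
     tight_fusion_frame W \<and> (\<exists>m. \<forall>i. dim (W i) = m) \<and>
     (\<exists>d. \<forall>i j. i \<noteq> j \<longrightarrow> chordal_dist (W i) (W j) = d)"


section \<open>Measurement model and LMMSE estimation\<close>

definition corr_matrix ::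
    "'a measure \<Rightarrow> ('a \<Rightarrow> real^'p) \<Rightarrow> ('a \<Rightarrow> real^'q) \<Rightarrow> real^'q^'p" where
  "corr_matrix Pr u v = (\<chi> k l. LINT \<omega>|Pr. u \<omega> $ k * v \<omega> $ l)"

definition square_integrable :: "'a measure \<Rightarrow> ('a \<Rightarrow> real^'p) \<Rightarrow> bool" where
  "square_integrable Pr u \<longleftrightarrow> u \<in> borel_measurable Pr \<and> integrable Pr (\<lambda>\<omega>. (norm (u \<omega>))\<^sup>2)"

text \<open>
  Uncorrelatedness is the vanishing of the second moments E[u v^T]. As x has mean zero, for x and
  a noise vector this is the vanishing of their covariance; for two noise vectors it is that too
  when the noise has mean zero, which is not required here.
\<close>

definition signal_model ::
    "'a measure \<Rightarrow> ('a \<Rightarrow> real^'m) \<Rightarrow> ('n \<Rightarrow> 'a \<Rightarrow> real^'m) \<Rightarrow> real \<Rightarrow> real \<Rightarrow> bool" where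
  "signal_model Pr x n \<sigma>x \<sigma>n \<longleftrightarrow>
     prob_space Pr \<and> square_integrable Pr x \<and> (\<forall>i. square_integrable Pr (n i)) \<and>
     (LINT \<omega>|Pr. x \<omega>) = 0 \<and>
     corr_matrix Pr x x = \<sigma>x\<^sup>2 *\<^sub>R mat 1 \<and>
     (\<forall>i. corr_matrix Pr x (n i) = 0) \<and>
     (\<forall>i j. i \<noteq> j \<longrightarrow> corr_matrix Pr (n i) (n j) = 0) \<and>
     (\<forall>i. corr_matrix Pr (n i) (n i) = \<sigma>n\<^sup>2 *\<^sub>R mat 1)"

text \<open>
  Stacked vectors, of length NM, are indexed by pairs (i, k): block i, coordinate k in the block.
\<close>

definition measurement ::
    "('n::finite \<Rightarrow> (real^'m) set) \<Rightarrow> ('a \<Rightarrow> real^'m) \<Rightarrow> ('n \<Rightarrow> 'a \<Rightarrow> real^'m) \<Rightarrow> 'a \<Rightarrow> real^('n \<times> 'm)"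
  where
  "measurement W x n \<omega> = (\<chi> p. (proj_matrix (W (fst p)) *v x \<omega> + n (fst p) \<omega>) $ snd p)"

definition lmmse_filter ::
    "'a measure \<Rightarrow> ('a \<Rightarrow> real^'p) \<Rightarrow> ('a \<Rightarrow> real^'q) \<Rightarrow> real^'q^'p" where
  "lmmse_filter Pr x z = corr_matrix Pr x z ** matrix_inv (corr_matrix Pr z z)"

definition erasure_matrix :: "'n set \<Rightarrow> real^('n::finite \<times> 'm::finite)^('n \<times> 'm)" where
  "erasure_matrix S = (\<chi> p q. if p = q \<and> fst p \<in> S then 1 else 0)"

definition erasure_estimate ::
    "'a measure \<Rightarrow> ('n::finite \<Rightarrow> (real^'m) set) \<Rightarrow> ('a \<Rightarrow> real^'m) \<Rightarrow> ('n \<Rightarrow> 'a \<Rightarrow> real^'m)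
      \<Rightarrow> 'n set \<Rightarrow> 'a \<Rightarrow> real^'m" where
  "erasure_estimate Pr W x n S \<omega> =
     lmmse_filter Pr x (measurement W x n) *v
       ((mat 1 - erasure_matrix S) *v measurement W x n \<omega>)"

definition erasure_mse ::
    "'a measure \<Rightarrow> ('n::finite \<Rightarrow> (real^'m) set) \<Rightarrow> ('a \<Rightarrow> real^'m) \<Rightarrow> ('n \<Rightarrow> 'a \<Rightarrow> real^'m)
      \<Rightarrow> 'n set \<Rightarrow> real" where
  "erasure_mse Pr W x n S =
     (let e = (\<lambda>\<omega>. x \<omega> - erasure_estimate Pr W x n S \<omega>) in trace (corr_matrix Pr e e))"

definition two_erasure_mse ::
    "'a measure \<Rightarrow> ('n::finite \<Rightarrow> (real^'m) set) \<Rightarrow> ('a \<Rightarrow> real^'m) \<Rightarrow> ('n \<Rightarrow> 'a \<Rightarrow> real^'m) \<Rightarrow> real"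
  where
  "two_erasure_mse Pr W x n = Max {erasure_mse Pr W x n {i, j} |i j. i \<noteq> j}"

end

theory Submission
  imports Defs
begin

text \<open>
  The theorem is an averaging argument. Write \<open>P\<^sub>i\<close> for the projections, \<open>s\<close> and \<open>t\<close> for the
  variances of the signal and the noise, and let \<open>\<Sum>P\<^sub>i = A I\<close>. Tightness makes the LMMSE filter a
  multiple of the adjoint of the stacked projections: it maps the measurements \<open>z\<^sub>i\<close> to
  \<open>\<alpha> \<Sum>P\<^sub>i z\<^sub>i\<close> with \<open>\<alpha> = s / (s A + t)\<close> (\<open>tight_lmmse_filter\<close>). When the blocks in \<open>S\<close> are erased, the
  error is \<open>B x - \<alpha> \<Sum>P\<^sub>i n\<^sub>i\<close>, the sum running over \<open>i \<notin> S\<close>, where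
  \<open>B = (1 - \<alpha> A) I + \<alpha> \<Sum>P\<^sub>i\<close> with the sum over \<open>i \<in> S\<close>. Its mean square is
  \<open>s \<parallel>B\<parallel>\<^sup>2\<close> plus a noise term that depends only on dimensions. For \<open>S = {i, j}\<close>, expanding the
  Frobenius norm of \<open>B\<close> leaves a constant plus \<open>2 s \<alpha>\<^sup>2 tr(P\<^sub>i P\<^sub>j)\<close>, and the constant is the same for
  all tight fusion frames with these parameters, because comparing traces gives \<open>A = N m / M\<close>
  (\<open>erasure_mse_pair\<close>).

  Minimizing the worst pair therefore means minimizing the largest \<open>tr(P\<^sub>i P\<^sub>j)\<close>, \<open>i \<noteq> j\<close>. Squaring
  \<open>\<Sum>P\<^sub>i = A I\<close> and taking traces shows that the sum of these numbers over all pairs is the same for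
  all the frames in question (\<open>tight_fusion_frame_sum_off_diagonal\<close>). Their maximum is at least
  their average, with equality when they all coincide; and they do coincide for an equi-distance
  frame, since the squared chordal distance is \<open>m - tr(P\<^sub>i P\<^sub>j)\<close> (\<open>chordal_dist_eq\<close>).

  The last identity has to be derived from the recursive definition of principal angles. Maximality
  of each pair of principal vectors forces the two orthonormal families to be biorthogonal
  (\<open>principal_vectors_biorthogonal\<close>), so that in these bases \<open>tr(P\<^sub>i P\<^sub>j)\<close> is the sum of the squared
  cosines of the principal angles.

  Throughout, \<open>tr(X Y\<^sup>T)\<close> is written as the inner product \<open>X \<bullet> Y\<close> of the matrix space, so that traces
  of products of projections can be expanded bilinearly.
\<close>
section \<open>Orthogonal projections and orthonormal bases\<close>

definition outer_square :: "real^'m \<Rightarrow> real^'m^'m" where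
  "outer_square v = (\<chi> i j. v $ i * v $ j)"

lemma outer_square_mult_vec: "outer_square u *v v = (u \<bullet> v) *\<^sub>R u"
  by (simp add: outer_square_def vec_eq_iff matrix_vector_mult_def inner_vec_def
      sum_distrib_left sum_distrib_right mult_ac)

lemma inner_outer_square: "outer_square u \<bullet> outer_square v = (u \<bullet> v)\<^sup>2"
  by (simp add: outer_square_def inner_vec_def power2_eq_square sum_product mult_ac)

lemma inner_outer_square_mat_1: "outer_square u \<bullet> mat 1 = u \<bullet> u"
  by (simp add: outer_square_def inner_vec_def mat_def if_distrib cong: if_cong)

lemma trace_mult_transpose:
  "trace (X ** Finite_Cartesian_Product.transpose Y) = X \<bullet> (Y :: real^'m^'n)"
  by (simp add: trace_def matrix_matrix_mult_def transpose_def inner_vec_def)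

lemma sum_mult_vec: "(\<Sum>i\<in>I. X i) *v v = (\<Sum>i\<in>I. X i *v (v :: real^'m))"
  by (induction I rule: infinite_finite_induct) (auto simp: matrix_vector_mult_add_rdistrib)

lemma proj_matrix_prop:
  assumes "subspace U"
  shows "proj_matrix U *v v \<in> U" "u \<in> U \<Longrightarrow> orthogonal (v - proj_matrix U *v v) u"
  using theI'[OF proj_matrix_unique_existence[OF assms], folded proj_matrix_def] by auto

lemma proj_matrix_eqI:
  assumes "subspace U"
    and "\<And>v. P *v v \<in> U" "\<And>v u. u \<in> U \<Longrightarrow> orthogonal (v - P *v v) u"
  shows "proj_matrix U = P"
  unfolding proj_matrix_def
  by (rule the1_equality[OF proj_matrix_unique_existence]) (use assms in auto)

lemma inner_span_zero:
  fixes v :: "'b :: euclidean_space"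
  assumes "\<And>i. i \<in> I \<Longrightarrow> v \<bullet> a i = 0" "u \<in> span (a ` I)"
  shows "v \<bullet> u = 0"
  using orthogonal_to_span[of u "a ` I" v] assms by (auto simp: orthogonal_def)

lemma orthonormal_proj_matrix:
  assumes "subspace U" "finite I" "span (a ` I) = U"
    and on: "\<And>i j. i \<in> I \<Longrightarrow> j \<in> I \<Longrightarrow> a i \<bullet> a j = (if i = j then 1 else 0)"
  shows "proj_matrix U = (\<Sum>i\<in>I. outer_square (a i))"
proof (rule proj_matrix_eqI[OF assms(1)])
  have a: "a i \<in> U" if "i \<in> I" for i using that assms(3) by (auto intro: span_base)
  show "(\<Sum>i\<in>I. outer_square (a i)) *v v \<in> U" for v
    using a assms(1) by (auto simp: sum_mult_vec outer_square_mult_vec intro!: subspace_sum subspace_scale)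
  fix v u assume u: "u \<in> U"
  have "(v - (\<Sum>i\<in>I. outer_square (a i)) *v v) \<bullet> a j = 0" if "j \<in> I" for j
  proof -
    have "(\<Sum>i\<in>I. (a i \<bullet> v) * (a i \<bullet> a j)) = (\<Sum>i\<in>I. if i = j then a j \<bullet> v else 0)"
      using on that by (intro sum.cong) auto
    then show ?thesis using that assms(2)
      by (simp add: inner_diff_left sum_mult_vec outer_square_mult_vec inner_sum_left
          inner_commute[of v "a j"])
  qed
  then show "orthogonal (v - (\<Sum>i\<in>I. outer_square (a i)) *v v) u"
    using u assms(3) unfolding orthogonal_def
    by (auto intro: inner_span_zero[of I _ a u])
qed

lemma orthonormal_dim_spans:
  fixes a :: "nat \<Rightarrow> real^'m"
  assumes "subspace U" and "\<And>i. i < dim U \<Longrightarrow> a i \<in> U"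
    and on: "\<And>i j. i < dim U \<Longrightarrow> j < dim U \<Longrightarrow> a i \<bullet> a j = (if i = j then 1 else 0)"
  shows "span (a ` {..<dim U}) = U"
proof -
  have inj: "inj_on a {..<dim U}"
  proof (rule inj_onI)
    fix i j assume "i \<in> {..<dim U}" "j \<in> {..<dim U}" "a i = a j"
    then show "i = j" using on[of i j] on[of j j] by (simp split: if_splits)
  qed
  have "pairwise orthogonal (a ` {..<dim U})"
    unfolding pairwise_def orthogonal_def using on by auto
  moreover have "0 \<notin> a ` {..<dim U}" using on by fastforce
  ultimately have "independent (a ` {..<dim U})" by (rule pairwise_orthogonal_independent)
  then have "U \<subseteq> span (a ` {..<dim U})"
    using assms(2) inj by (subst card_eq_dim[symmetric]) (auto simp: card_image)
  moreover have "span (a ` {..<dim U}) \<subseteq> U"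
    using assms by (intro span_minimal) auto
  ultimately show ?thesis by blast
qed

lemma proj_matrix_symmetric:
  assumes "subspace (U :: (real^'m) set)"
  shows "Finite_Cartesian_Product.transpose (proj_matrix U) = proj_matrix U"
proof -
  let ?P = "proj_matrix U"
  have half: "v \<bullet> (?P *v w) = (?P *v v) \<bullet> (?P *v w)" for v w
    using proj_matrix_prop(2)[OF assms proj_matrix_prop(1)[OF assms, of w], of v]
    by (simp add: orthogonal_def inner_diff_left)
  have sym: "v \<bullet> (?P *v w) = w \<bullet> (?P *v v)" for v w
    unfolding half[of v w] half[of w v] by (rule inner_commute)
  have "v \<bullet> (Finite_Cartesian_Product.transpose ?P *v w) = v \<bullet> (?P *v w)" for v w
    unfolding sym[of v w] transpose_matrix_vector
    by (subst inner_commute) (rule dot_lmul_matrix)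
  then have "Finite_Cartesian_Product.transpose ?P *v w = ?P *v w" for w
    using vector_eq_ldot[of "Finite_Cartesian_Product.transpose ?P *v w" "?P *v w"] by blast
  then show ?thesis using matrix_eq by blast
qed

lemma proj_matrix_idempotent:
  assumes "subspace (U :: (real^'m) set)"
  shows "proj_matrix U ** proj_matrix U = proj_matrix U"
proof -
  let ?P = "proj_matrix U"
  have "?P *v u = u" if "u \<in> U" for u
  proof -
    have "u - ?P *v u \<in> U" using assms that proj_matrix_prop(1) by (intro subspace_diff)
    then have "orthogonal (u - ?P *v u) (u - ?P *v u)" using proj_matrix_prop(2)[OF assms] by blast
    then show ?thesis by (simp add: orthogonal_self)
  qed
  then show ?thesis using proj_matrix_prop(1)[OF assms]
    by (simp add: matrix_eq flip: matrix_vector_mul_assoc)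
qed

lemma proj_matrix_inner_mat_1:
  assumes "subspace (U :: (real^'m) set)"
  shows "proj_matrix U \<bullet> mat 1 = dim U"
proof -
  obtain B where B: "B \<subseteq> U" "pairwise orthogonal B" "\<And>x. x \<in> B \<Longrightarrow> norm x = 1"
    "independent B" "card B = dim U" "span B = U"
    using orthonormal_basis_subspace[OF assms] by metis
  have on: "u \<bullet> v = (if u = v then 1 else 0)" if "u \<in> B" "v \<in> B" for u v
    using B(2,3) that by (auto simp: pairwise_def orthogonal_def norm_eq_1)
  have "finite B" using B(4) by (rule independent_imp_finite)
  then have "proj_matrix U = (\<Sum>u\<in>B. outer_square u)"
    using orthonormal_proj_matrix[of U B "\<lambda>x. x"] assms B on by simp
  then have "proj_matrix U \<bullet> mat 1 = (\<Sum>u\<in>B. u \<bullet> u)"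
    by (simp only: inner_sum_left inner_outer_square_mat_1)
  also have "\<dots> = (\<Sum>u\<in>B. 1)" using on by (intro sum.cong) auto
  finally show ?thesis using B(5) by simp
qed

text \<open>
  A projection equals \<open>P P\<^sup>T\<close>, so its squared Frobenius norm is its trace.
\<close>
lemma proj_matrix_inner_self:
  assumes "subspace (U :: (real^'m) set)"
  shows "proj_matrix U \<bullet> proj_matrix U = dim U"
proof -
  let ?P = "proj_matrix U"
  have "?P ** Finite_Cartesian_Product.transpose ?P = ?P ** Finite_Cartesian_Product.transpose (mat 1)"
    by (simp add: proj_matrix_symmetric assms proj_matrix_idempotent transpose_mat)
  from arg_cong[OF this, of trace] have "?P \<bullet> ?P = ?P \<bullet> mat 1"
    unfolding trace_mult_transpose .
  then show ?thesis by (simp add: proj_matrix_inner_mat_1[OF assms])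
qed


section \<open>Principal angles and the chordal distance\<close>

text \<open>
  A linear functional on the plane attains its maximum over the unit circle in the direction of its
  coefficient vector. If the maximum is attained at \<open>(1, 0)\<close>, the second coefficient vanishes. This
  is the first-order condition at a pair of principal vectors, without derivatives.
\<close>
lemma circle_max_imp_zero:
  fixes p q :: real
  assumes "\<And>c s. c\<^sup>2 + s\<^sup>2 = 1 \<Longrightarrow> c * p + s * q \<le> p"
  shows "q = 0"
proof (rule ccontr)
  assume "q \<noteq> 0"
  define r where "r = sqrt (p\<^sup>2 + q\<^sup>2)"
  have r: "r > 0" "r\<^sup>2 = p\<^sup>2 + q\<^sup>2" using \<open>q \<noteq> 0\<close> by (auto simp: r_def sum_power2_gt_zero_iff)
  have "(p / r)\<^sup>2 + (q / r)\<^sup>2 = (p\<^sup>2 + q\<^sup>2) / r\<^sup>2"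
    by (simp add: power_divide add_divide_distrib)
  also have "\<dots> = 1" unfolding r(2)[symmetric] using r(1) by simp
  finally have "(p / r)\<^sup>2 + (q / r)\<^sup>2 = 1" .
  \<comment> \<open>Evaluated at the unit vector in the direction of \<open>(p, q)\<close>, the functional takes the value \<open>r\<close>.\<close>
  from assms[OF this] have "(p\<^sup>2 + q\<^sup>2) / r \<le> p"
    by (simp add: power2_eq_square add_divide_distrib)
  moreover have "(p\<^sup>2 + q\<^sup>2) / r = r" unfolding r(2)[symmetric] by (simp add: power2_eq_square)
  ultimately have "r \<le> p" by simp
  then have "r\<^sup>2 \<le> p\<^sup>2" using r(1) by (intro power_mono) auto
  then show False using r(2) \<open>q \<noteq> 0\<close> by simp
qed

text \<open>
  The unit vectors over which step \<open>l\<close> of the recursive definition of principal vectors optimizes.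
\<close>
definition candidates :: "(real^'m) set \<Rightarrow> (nat \<Rightarrow> real^'m) \<Rightarrow> nat \<Rightarrow> (real^'m) set" where
  "candidates U a l = {u \<in> U. norm u = 1 \<and> (\<forall>k<l. orthogonal (a k) u)}"

text \<open>
  The first \<open>L\<close> steps of that recursion, with the length separated from the dimension so that
  existence can be proved by induction on it. Maximal inner products replace minimal angles.
\<close>
definition principal_vectors ::
    "(real^'m) set \<Rightarrow> (real^'m) set \<Rightarrow> nat \<Rightarrow> (nat \<Rightarrow> real^'m) \<Rightarrow> (nat \<Rightarrow> real^'m) \<Rightarrow> bool" where
  "principal_vectors U V L a b \<longleftrightarrow>
     (\<forall>l<L. a l \<in> candidates U a l \<and> b l \<in> candidates V b l \<and>
        (\<forall>u\<in>candidates U a l. \<forall>v\<in>candidates V b l. u \<bullet> v \<le> a l \<bullet> b l))"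

lemma abs_inner_unit_le_1:
  fixes u v :: "'b :: real_inner"
  assumes "norm u = 1" "norm v = 1"
  shows "\<bar>u \<bullet> v\<bar> \<le> 1"
  using Cauchy_Schwarz_ineq2[of u v] assms by simp

lemma principal_angles_iff_principal_vectors:
  "principal_angles U V \<theta> \<longleftrightarrow>
     (\<exists>a b. principal_vectors U V (dim U) a b \<and> (\<forall>l<dim U. \<theta> l = arccos (a l \<bullet> b l)))"
proof -
  have "arccos (p \<bullet> q) \<le> arccos (u \<bullet> v) \<longleftrightarrow> u \<bullet> v \<le> p \<bullet> q"
    if "p \<in> candidates U a l" "u \<in> candidates U a l" "q \<in> candidates V b l" "v \<in> candidates V b l"
    for p q u v a b l
    using that by (intro arccos_le_mono abs_inner_unit_le_1) (auto simp: candidates_def)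
  then show ?thesis
    unfolding principal_angles_def principal_vectors_def Let_def candidates_def[symmetric]
    by (intro ex_cong1) (auto 4 4)
qed

lemma candidates_rotate:
  assumes "subspace U" "u \<in> candidates U a l" "v \<in> candidates U a l" "orthogonal u v" "c\<^sup>2 + s\<^sup>2 = 1"
  shows "c *\<^sub>R u + s *\<^sub>R v \<in> candidates U a l"
proof -
  have "(c *\<^sub>R u + s *\<^sub>R v) \<bullet> (c *\<^sub>R u + s *\<^sub>R v) = c\<^sup>2 * (u \<bullet> u) + s\<^sup>2 * (v \<bullet> v)"
    using assms(4) by (simp add: inner_add orthogonal_def inner_commute power2_eq_square)
  then have "norm (c *\<^sub>R u + s *\<^sub>R v) = 1"
    using assms by (simp add: candidates_def norm_eq_1)
  then show ?thesis
    using assms by (auto simp: candidates_def orthogonal_def inner_add_right intro!: subspace_add subspace_scale)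
qed

lemma candidates_antimono: "k \<le> l \<Longrightarrow> candidates U a l \<subseteq> candidates U a k"
  by (auto simp: candidates_def)

lemma candidates_orthonormal:
  assumes "\<And>l. l < L \<Longrightarrow> a l \<in> candidates U a l" "i < L" "j < L"
  shows "a i \<bullet> a j = (if i = j then 1 else 0)"
  using assms(1)[OF assms(2)] assms(1)[OF assms(3)]
  by (cases i j rule: linorder_cases) (auto simp: candidates_def orthogonal_def norm_eq_1 inner_commute)

lemma principal_vectors_swap: "principal_vectors U V L a b \<Longrightarrow> principal_vectors V U L b a"
  unfolding principal_vectors_def by (metis inner_commute)

text \<open>
  Both \<open>b k\<close> and the later \<open>b l\<close> are admissible at step \<open>k\<close>, hence so is every rotation between them.
  As \<open>b k\<close> is optimal against \<open>a k\<close> on that circle, the component of \<open>a k\<close> along \<open>b l\<close> vanishes.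
\<close>
lemma principal_vectors_biorthogonal_less:
  assumes "subspace V" "principal_vectors U V L a b" "k < l" "l < L"
  shows "a k \<bullet> b l = 0"
proof (rule circle_max_imp_zero[of "a k \<bullet> b k"])
  fix c s :: real assume cs: "c\<^sup>2 + s\<^sup>2 = 1"
  have k: "a k \<in> candidates U a k" "b k \<in> candidates V b k"
    and max: "\<And>u v. u \<in> candidates U a k \<Longrightarrow> v \<in> candidates V b k \<Longrightarrow> u \<bullet> v \<le> a k \<bullet> b k"
    and l: "b l \<in> candidates V b l"
    using assms by (auto simp: principal_vectors_def)
  have "b l \<in> candidates V b k" using l candidates_antimono[of k l] assms(3) by auto
  moreover have "orthogonal (b k) (b l)" using l assms(3) by (simp add: candidates_def)
  ultimately have "c *\<^sub>R b k + s *\<^sub>R b l \<in> candidates V b k"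
    using candidates_rotate assms(1) k cs by blast
  from max[OF k(1) this] show "c * (a k \<bullet> b k) + s * (a k \<bullet> b l) \<le> a k \<bullet> b k"
    by (simp add: inner_add_right)
qed

lemma principal_vectors_biorthogonal:
  assumes "subspace U" "subspace V" "principal_vectors U V L a b" "k < L" "l < L" "k \<noteq> l"
  shows "a k \<bullet> b l = 0"
proof (cases "k < l")
  case True
  then show ?thesis using principal_vectors_biorthogonal_less assms by blast
next
  case False
  then have "b l \<bullet> a k = 0"
    using principal_vectors_biorthogonal_less[OF assms(1) principal_vectors_swap] assms by auto
  then show ?thesis by (simp add: inner_commute)
qed

text \<open>
  A full set of principal vectors consists of orthonormal bases \<open>a\<close> of \<open>U\<close> and \<open>b\<close> of \<open>V\<close>. Expanding
  both projections in them gives \<open>\<Sum>(a k \<bullet> b l)\<^sup>2\<close> over all \<open>k\<close> and \<open>l\<close>, and biorthogonality leaves only the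
  squared cosines on the diagonal.
\<close>
lemma principal_vectors_sin_squared_sum:
  assumes U: "subspace U" and V: "subspace V" and dim: "dim V = dim U"
    and pv: "principal_vectors U V (dim U) a b"
  shows "(\<Sum>l<dim U. (sin (arccos (a l \<bullet> b l)))\<^sup>2) = dim U - proj_matrix U \<bullet> proj_matrix V"
proof -
  let ?I = "{..<dim U}"
  have a: "a l \<in> candidates U a l" and b: "b l \<in> candidates V b l" if "l < dim U" for l
    using pv that by (auto simp: principal_vectors_def)
  note ona = candidates_orthonormal[where a = a, OF a] and onb = candidates_orthonormal[where a = b, OF b]
  have "span (a ` ?I) = U"
    using a ona by (intro orthonormal_dim_spans[OF U]) (auto simp: candidates_def)
  then have PU: "proj_matrix U = (\<Sum>k\<in>?I. outer_square (a k))"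
    using ona by (intro orthonormal_proj_matrix U) auto
  have "span (b ` {..<dim V}) = V"
    using b onb dim by (intro orthonormal_dim_spans[OF V]) (auto simp: candidates_def)
  then have PV: "proj_matrix V = (\<Sum>k\<in>?I. outer_square (b k))"
    using onb dim by (intro orthonormal_proj_matrix V) auto
  have "proj_matrix U \<bullet> proj_matrix V = (\<Sum>k\<in>?I. \<Sum>l\<in>?I. (a k \<bullet> b l)\<^sup>2)"
    unfolding PU PV inner_sum_left inner_sum_right inner_outer_square by (rule sum.swap)
  also have "\<dots> = (\<Sum>k\<in>?I. \<Sum>l\<in>?I. if l = k then (a k \<bullet> b k)\<^sup>2 else 0)"
    using principal_vectors_biorthogonal[OF U V pv] by (intro sum.cong) auto
  finally have tr: "proj_matrix U \<bullet> proj_matrix V = (\<Sum>k\<in>?I. (a k \<bullet> b k)\<^sup>2)" by simp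
  have "(sin (arccos (a l \<bullet> b l)))\<^sup>2 = 1 - (a l \<bullet> b l)\<^sup>2" if "l < dim U" for l
  proof -
    have "\<bar>a l \<bullet> b l\<bar> \<le> 1"
      using a[OF that] b[OF that] by (intro abs_inner_unit_le_1) (auto simp: candidates_def)
    then show ?thesis by (simp add: sin_squared_eq cos_arccos_abs)
  qed
  then show ?thesis by (simp add: tr sum_subtractf)
qed

text \<open>
  Fewer than \<open>dim U\<close> vectors cannot span \<open>U\<close>, so some direction in \<open>U\<close> is orthogonal to them.
\<close>
lemma candidates_nonempty:
  assumes "subspace U" "\<And>k. k < l \<Longrightarrow> a k \<in> U" "l < dim U"
  shows "candidates U a l \<noteq> {}"
proof -
  have sub: "span (a ` {..<l}) \<subseteq> U" using assms by (intro span_minimal) auto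
  have "dim (span (a ` {..<l})) \<le> card (a ` {..<l})" by (simp add: dim_le_card')
  also have "\<dots> \<le> l" using card_image_le[of "{..<l}" a] by simp
  finally have "span (a ` {..<l}) \<noteq> U" using assms(3) by auto
  then have "span (a ` {..<l}) \<subset> span U"
    using sub assms(1) by (simp add: psubset_eq span_eq_iff[THEN iffD2])
  then obtain x where x: "x \<noteq> 0" "x \<in> span U" "\<And>y. y \<in> span (a ` {..<l}) \<Longrightarrow> orthogonal x y"
    using orthogonal_to_subspace_exists_gen by blast
  have "x \<in> U" using x(2) assms(1) by (simp add: span_eq_iff[THEN iffD2])
  moreover have "orthogonal (a k) x" if "k < l" for k
    using x(3)[of "a k"] that by (simp add: span_base orthogonal_commute)
  ultimately have "x /\<^sub>R norm x \<in> candidates U a l"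
    using x(1) assms(1) by (simp add: candidates_def subspace_scale orthogonal_clauses)
  then show ?thesis by blast
qed

lemma candidates_compact:
  fixes U :: "(real^'m) set"
  assumes "subspace U"
  shows "compact (candidates U a l)"
proof -
  have "candidates U a l = sphere 0 1 \<inter> (U \<inter> (\<Inter>k\<in>{..<l}. {u. a k \<bullet> u = 0}))"
    by (auto simp: candidates_def orthogonal_def)
  moreover have "closed (U \<inter> (\<Inter>k\<in>{..<l}. {u. a k \<bullet> u = 0}))"
    by (intro closed_Int closed_INT ballI closed_hyperplane closed_subspace assms)
  ultimately show ?thesis by (simp add: compact_Int_closed)
qed

text \<open>
  Each step maximizes a continuous function over a nonempty compact set, and so extends the pairs
  already chosen.
\<close>
lemma principal_vectors_exist:
  fixes U V :: "(real^'m) set"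
  assumes U: "subspace U" and V: "subspace V"
  shows "L \<le> dim U \<Longrightarrow> L \<le> dim V \<Longrightarrow> \<exists>a b. principal_vectors U V L a b"
proof (induction L)
  case 0
  then show ?case by (simp add: principal_vectors_def)
next
  case (Suc L)
  then obtain a b where ab: "principal_vectors U V L a b" by auto
  let ?X = "candidates U a L" and ?Y = "candidates V b L"
  have "a k \<in> U" "b k \<in> V" if "k < L" for k
    using ab that by (auto simp: principal_vectors_def candidates_def)
  then have "?X \<noteq> {}" "?Y \<noteq> {}"
    using Suc.prems candidates_nonempty[OF U, of L a] candidates_nonempty[OF V, of L b] by auto
  then have ne: "?X \<times> ?Y \<noteq> {}" by simp
  have cpt: "compact (?X \<times> ?Y)" by (intro compact_Times candidates_compact U V)
  have cont: "continuous_on (?X \<times> ?Y) (\<lambda>p. fst p \<bullet> snd p)" by (intro continuous_intros)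
  obtain p where p: "p \<in> ?X \<times> ?Y" "\<forall>q\<in>?X \<times> ?Y. fst q \<bullet> snd q \<le> fst p \<bullet> snd p"
    using continuous_attains_sup[OF cpt ne cont] by (elim bexE)
  have upd: "candidates T (f(L := w)) l = candidates T f l" if "l \<le> L" for T :: "(real^'m) set" and f w l
    using that by (auto simp: candidates_def)
  have "principal_vectors U V (Suc L) (a(L := fst p)) (b(L := snd p))"
    using ab p by (auto simp: principal_vectors_def upd less_Suc_eq)
  then show ?case by blast
qed

text \<open>
  The chordal distance is a definite description over all possible choices of principal angles.
  Existence of principal vectors supplies a value, and the sum formula shows that every choice
  yields the same one.
\<close>
lemma chordal_dist_eq:
  fixes U V :: "(real^'m) set"
  assumes "subspace U" "subspace V" "dim V = dim U"
  shows "chordal_dist U V = sqrt (dim U - proj_matrix U \<bullet> proj_matrix V)"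
  unfolding chordal_dist_def
proof (rule the_equality)
  obtain a b where "principal_vectors U V (dim U) a b"
    using principal_vectors_exist[OF assms(1,2), of "dim U"] assms(3) by auto
  then show "\<exists>\<theta>. principal_angles U V \<theta> \<and>
      sqrt (dim U - proj_matrix U \<bullet> proj_matrix V) = sqrt (\<Sum>l<dim U. (sin (\<theta> l))\<^sup>2)"
    using principal_vectors_sin_squared_sum[OF assms]
    unfolding principal_angles_iff_principal_vectors
    by (intro exI[of _ "\<lambda>l. arccos (a l \<bullet> b l)"]) auto
next
  fix d assume "\<exists>\<theta>. principal_angles U V \<theta> \<and> d = sqrt (\<Sum>l<dim U. (sin (\<theta> l))\<^sup>2)"
  then obtain \<theta> a b where "principal_vectors U V (dim U) a b"
    and \<theta>: "\<And>l. l < dim U \<Longrightarrow> \<theta> l = arccos (a l \<bullet> b l)"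
    and d: "d = sqrt (\<Sum>l<dim U. (sin (\<theta> l))\<^sup>2)"
    unfolding principal_angles_iff_principal_vectors by blast
  then have "(\<Sum>l<dim U. (sin (arccos (a l \<bullet> b l)))\<^sup>2) = dim U - proj_matrix U \<bullet> proj_matrix V"
    using principal_vectors_sin_squared_sum assms by blast
  then show "d = sqrt (dim U - proj_matrix U \<bullet> proj_matrix V)"
    using \<theta> by (simp add: d)
qed

section \<open>Second moments in the measurement model\<close>

lemma trace_eq_inner_mat_1: "trace X = X \<bullet> mat 1"
  unfolding trace_def inner_vec_def mat_def inner_real_def
  by (simp add: if_distrib[of "\<lambda>t. _ * t"] cong: if_cong)

lemma mult_transpose_inner_mat_1:
  "(X ** Finite_Cartesian_Product.transpose Y) \<bullet> mat 1 = X \<bullet> (Y :: real^'m^'n)"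
  unfolding trace_eq_inner_mat_1[symmetric] by (rule trace_mult_transpose)

lemma square_integrable_integrable_mult:
  fixes u :: "'a \<Rightarrow> real^'p" and v :: "'a \<Rightarrow> real^'q"
  assumes "square_integrable Pr u" "square_integrable Pr v"
  shows "integrable Pr (\<lambda>\<omega>. u \<omega> $ k * v \<omega> $ l)"
proof (rule Bochner_Integration.integrable_bound)
  show "integrable Pr (\<lambda>\<omega>. (norm (u \<omega>))\<^sup>2 + (norm (v \<omega>))\<^sup>2)"
    using assms by (simp add: square_integrable_def)
  have "(\<lambda>\<omega>. u \<omega> $ k) \<in> borel_measurable Pr" "(\<lambda>\<omega>. v \<omega> $ l) \<in> borel_measurable Pr"
    using assms unfolding square_integrable_def
    by (auto intro!: borel_measurable_continuous_on[where f = "\<lambda>w. w $ _"] continuous_intros)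
  then show "(\<lambda>\<omega>. u \<omega> $ k * v \<omega> $ l) \<in> borel_measurable Pr" by simp
  have "norm (u \<omega> $ k * v \<omega> $ l) \<le> norm ((norm (u \<omega>))\<^sup>2 + (norm (v \<omega>))\<^sup>2)" for \<omega>
  proof -
    have "norm (u \<omega> $ k * v \<omega> $ l) \<le> norm (u \<omega>) * norm (v \<omega>)"
      by (simp add: abs_mult mult_mono component_le_norm_cart)
    also have "\<dots> \<le> (norm (u \<omega>))\<^sup>2 + (norm (v \<omega>))\<^sup>2"
      using sum_squares_bound[of "norm (u \<omega>)" "norm (v \<omega>)"]
        mult_nonneg_nonneg[OF norm_ge_zero[of "u \<omega>"] norm_ge_zero[of "v \<omega>"]] by linarith
    finally show ?thesis by simp
  qed
  then show "AE \<omega> in Pr. norm (u \<omega> $ k * v \<omega> $ l) \<le> norm ((norm (u \<omega>))\<^sup>2 + (norm (v \<omega>))\<^sup>2)"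
    by simp
qed

text \<open>
  Every random vector in the model (signal, measurement, estimation error) is a linear image of the
  signal and the noise vectors together. For linear images of an uncorrelated white family the
  cross terms vanish, and second moments reduce to matrix products.
\<close>
lemma corr_matrix_uncorrelated_family:
  fixes y :: "'k::finite \<Rightarrow> 'a \<Rightarrow> real^'m"
    and B :: "'k \<Rightarrow> real^'m^'p" and C :: "'k \<Rightarrow> real^'m^'q"
  assumes sq: "\<And>p. square_integrable Pr (y p)"
    and cross: "\<And>p q. p \<noteq> q \<Longrightarrow> corr_matrix Pr (y p) (y q) = 0"
    and self: "\<And>p. corr_matrix Pr (y p) (y p) = c p *\<^sub>R mat 1"
  shows "corr_matrix Pr (\<lambda>\<omega>. \<Sum>p\<in>UNIV. B p *v y p \<omega>) (\<lambda>\<omega>. \<Sum>p\<in>UNIV. C p *v y p \<omega>) =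
    (\<Sum>p\<in>UNIV. c p *\<^sub>R (B p ** Finite_Cartesian_Product.transpose (C p)))"
proof -
  have corr_nth: "(LINT \<omega>|Pr. y p \<omega> $ a * y q \<omega> $ b) = corr_matrix Pr (y p) (y q) $ a $ b" for p q a b
    by (simp add: corr_matrix_def)
  have moment: "(LINT \<omega>|Pr. y p \<omega> $ a * y q \<omega> $ b) = (if q = p then if b = a then c p else 0 else 0)"
    for p q a b
    unfolding corr_nth using cross self by (auto simp: mat_def)
  have "(LINT \<omega>|Pr. (\<Sum>p\<in>UNIV. B p *v y p \<omega>) $ k * (\<Sum>p\<in>UNIV. C p *v y p \<omega>) $ l) =
      (\<Sum>p\<in>UNIV. c p *\<^sub>R (B p ** Finite_Cartesian_Product.transpose (C p))) $ k $ l" for k l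
  proof -
    have "(\<lambda>\<omega>. (\<Sum>p\<in>UNIV. B p *v y p \<omega>) $ k * (\<Sum>p\<in>UNIV. C p *v y p \<omega>) $ l) =
      (\<lambda>\<omega>. \<Sum>p\<in>UNIV. \<Sum>a\<in>UNIV. \<Sum>q\<in>UNIV. \<Sum>b\<in>UNIV.
         (B p $ k $ a * C q $ l $ b) * (y p \<omega> $ a * y q \<omega> $ b))"
      unfolding sum_component matrix_vector_mult_def vec_lambda_beta sum_distrib_right
      unfolding sum_distrib_left by (simp add: mult_ac)
    moreover have "(LINT \<omega>|Pr. (\<Sum>p\<in>UNIV. \<Sum>a\<in>UNIV. \<Sum>q\<in>UNIV. \<Sum>b\<in>UNIV.
         (B p $ k $ a * C q $ l $ b) * (y p \<omega> $ a * y q \<omega> $ b))) =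
       (\<Sum>p\<in>UNIV. \<Sum>a\<in>UNIV. \<Sum>q\<in>UNIV. \<Sum>b\<in>UNIV.
         (B p $ k $ a * C q $ l $ b) * (LINT \<omega>|Pr. y p \<omega> $ a * y q \<omega> $ b))"
      by (simp add: integrable_sum integrable_mult_right square_integrable_integrable_mult[OF sq sq])
    moreover have "\<dots> = (\<Sum>p\<in>UNIV. \<Sum>a\<in>UNIV. (B p $ k $ a * C p $ l $ a) * c p)"
      unfolding moment by (simp add: if_distrib[of "\<lambda>t. _ * t"] sum.If_cases cong: if_cong)
    ultimately show ?thesis
      by (simp add: matrix_matrix_mult_def transpose_def sum_distrib_left mult_ac)
  qed
  then show ?thesis by (simp add: corr_matrix_def vec_eq_iff)
qed

lemma sum_UNIV_option:
  fixes f :: "'n::finite option \<Rightarrow> 'b::comm_monoid_add"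
  shows "(\<Sum>p\<in>UNIV. f p) = f None + (\<Sum>i\<in>UNIV. f (Some i))"
  by (simp add: UNIV_option_conv sum.reindex)

lemma corr_matrix_commute_zero:
  assumes "corr_matrix Pr u v = 0" shows "corr_matrix Pr v u = 0"
  using assms by (simp add: corr_matrix_def vec_eq_iff mult.commute)

lemma signal_model_corr_matrix:
  fixes B :: "real^'m^'p" and C :: "'n::finite \<Rightarrow> real^'m^'p"
    and B' :: "real^'m^'q" and C' :: "'n \<Rightarrow> real^'m^'q"
  assumes "signal_model Pr x n \<sigma>x \<sigma>n"
  shows "corr_matrix Pr (\<lambda>\<omega>. B *v x \<omega> + (\<Sum>i\<in>UNIV. C i *v n i \<omega>))
      (\<lambda>\<omega>. B' *v x \<omega> + (\<Sum>i\<in>UNIV. C' i *v n i \<omega>)) =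
    \<sigma>x\<^sup>2 *\<^sub>R (B ** Finite_Cartesian_Product.transpose B') +
    (\<Sum>i\<in>UNIV. \<sigma>n\<^sup>2 *\<^sub>R (C i ** Finite_Cartesian_Product.transpose (C' i)))"
proof -
  have model: "square_integrable Pr x" "\<And>i. square_integrable Pr (n i)"
    "corr_matrix Pr x x = \<sigma>x\<^sup>2 *\<^sub>R mat 1" "\<And>i. corr_matrix Pr x (n i) = 0"
    "\<And>i j. i \<noteq> j \<Longrightarrow> corr_matrix Pr (n i) (n j) = 0"
    "\<And>i. corr_matrix Pr (n i) (n i) = \<sigma>n\<^sup>2 *\<^sub>R mat 1"
    using assms unfolding signal_model_def by blast+
  \<comment> \<open>The signal joins the noise vectors as the member with index \<open>None\<close> of one uncorrelated family.\<close>
  have "corr_matrix Pr (\<lambda>\<omega>. \<Sum>p\<in>UNIV. case_option B C p *v case_option x n p \<omega>)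
      (\<lambda>\<omega>. \<Sum>p\<in>UNIV. case_option B' C' p *v case_option x n p \<omega>) =
    (\<Sum>p\<in>UNIV. case_option (\<sigma>x\<^sup>2) (\<lambda>_. \<sigma>n\<^sup>2) p *\<^sub>R
       (case_option B C p ** Finite_Cartesian_Product.transpose (case_option B' C' p)))"
    by (rule corr_matrix_uncorrelated_family)
      (auto split: option.split intro: model corr_matrix_commute_zero)
  then show ?thesis by (simp add: sum_UNIV_option)
qed


section \<open>The LMMSE filter of a tight fusion frame\<close>

definition stack :: "('n::finite \<Rightarrow> real^'m^'m) \<Rightarrow> real^'m^('n \<times> 'm)" where
  "stack X = (\<chi> p. X (fst p) $ snd p)"

lemma stack_mult_vec: "stack X *v v = (\<chi> p. (X (fst p) *v v) $ snd p)"
  by (simp add: stack_def matrix_vector_mult_def)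

lemma sum_UNIV_Times:
  fixes f :: "'n::finite \<times> 'm::finite \<Rightarrow> 'b::comm_monoid_add"
  shows "(\<Sum>p\<in>UNIV. f p) = (\<Sum>i\<in>UNIV. \<Sum>k\<in>UNIV. f (i, k))"
  by (simp add: sum.cartesian_product flip: UNIV_Times_UNIV)

lemma transpose_stack_mult_vec:
  "Finite_Cartesian_Product.transpose (stack X) *v w =
     (\<Sum>i\<in>UNIV. Finite_Cartesian_Product.transpose (X i) *v (\<chi> k. w $ (i, k)))"
  by (simp add: stack_def transpose_def matrix_vector_mult_def vec_eq_iff sum_UNIV_Times)

lemma transpose_stack_mult_stack:
  "Finite_Cartesian_Product.transpose (stack X) ** stack Y =
     (\<Sum>i\<in>UNIV. Finite_Cartesian_Product.transpose (X i) ** Y i)"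
  by (simp add: stack_def transpose_def matrix_matrix_mult_def vec_eq_iff sum_UNIV_Times)

text \<open>
  The noise \<open>n i\<close> enters through the embedding of \<open>\<real>\<^sup>M\<close> as block \<open>i\<close> of the stacked space, which is the
  stack with the identity in block \<open>i\<close> and zero elsewhere.
\<close>
lemma measurement_eq_stack:
  "measurement W x n \<omega> = stack (\<lambda>i. proj_matrix (W i)) *v x \<omega> +
     (\<Sum>i\<in>UNIV. stack (\<lambda>j. if j = i then mat 1 else 0) *v n i \<omega>)"
proof -
  have "(\<Sum>i\<in>UNIV. ((if j = i then mat 1 else 0) *v n i \<omega>) $ k) = n j \<omega> $ k" for j k
  proof -
    have "(\<Sum>i\<in>UNIV. ((if j = i then mat 1 else 0) *v n i \<omega>) $ k) =
        (\<Sum>i\<in>UNIV. if j = i then n i \<omega> $ k else 0)"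
      by (intro sum.cong) auto
    then show ?thesis by simp
  qed
  then show ?thesis by (simp add: measurement_def stack_mult_vec vec_eq_iff)
qed

lemma stacked_noise_covariance:
  "(\<Sum>i\<in>(UNIV :: 'n::finite set). c *\<^sub>R (stack (\<lambda>j. if j = i then mat 1 else 0) **
      Finite_Cartesian_Product.transpose (stack (\<lambda>j. if j = i then mat 1 else 0)))) =
   c *\<^sub>R (mat 1 :: real^('n \<times> 'm::finite)^('n \<times> 'm))" (is "sum ?f _ = _")
proof -
  have "(\<Sum>i\<in>UNIV. ?f i $ (j, k) $ (j', k')) = (c *\<^sub>R mat 1) $ (j, k) $ (j', k')"
    for j j' :: 'n and k k' :: 'm
  proof -
    have "?f i $ (j, k) $ (j', k') = (if j = i then if j' = j \<and> k = k' then c else 0 else 0)" for i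
      by (auto simp: stack_def matrix_matrix_mult_def transpose_def mat_def if_distrib cong: if_cong)
    then show ?thesis by (auto simp: mat_def)
  qed
  then show ?thesis by (simp add: vec_eq_iff)
qed

lemma matrix_add_rdistrib: "(A + B) ** C = A ** C + B ** (C :: 'b::semiring_1^'m^'n)"
  by (simp add: matrix_matrix_mult_def vec_eq_iff sum.distrib distrib_right)

text \<open>
  With \<open>Q = T T\<^sup>T\<close> and \<open>R = s Q + t I\<close>, tightness gives \<open>T\<^sup>T R = (s A + t) T\<^sup>T\<close>, so that \<open>s T\<^sup>T R\<^sup>-\<^sup>1\<close> is a
  multiple of \<open>T\<^sup>T\<close> once \<open>R\<close> is known to be invertible.
\<close>
lemma tight_lmmse_gain:
  fixes T :: "real^'m^'q"
  assumes T: "Finite_Cartesian_Product.transpose T ** T = A *\<^sub>R mat 1"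
    and "s > 0" "t > 0" "A > 0"
  shows "(s *\<^sub>R Finite_Cartesian_Product.transpose T) **
      matrix_inv (s *\<^sub>R (T ** Finite_Cartesian_Product.transpose T) + t *\<^sub>R mat 1) =
    (s / (s * A + t)) *\<^sub>R Finite_Cartesian_Product.transpose T"
proof -
  let ?T' = "Finite_Cartesian_Product.transpose T"
  define Q where "Q = T ** ?T'"
  define R where "R = s *\<^sub>R Q + t *\<^sub>R mat 1"
  define \<alpha> where "\<alpha> = s / (s * A + t)"
  have pos: "s * A + t > 0" using assms by (simp add: add_pos_pos)
  have T'Q: "?T' ** Q = A *\<^sub>R ?T'"
    unfolding Q_def by (simp add: matrix_mul_assoc T flip: scalar_matrix_assoc)
  have QQ: "Q ** Q = A *\<^sub>R Q"
    by (metis Q_def T'Q matrix_mul_assoc matrix_scalar_ac scalar_matrix_assoc)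
  have T'R: "?T' ** R = (s * A + t) *\<^sub>R ?T'"
    unfolding R_def by (simp add: matrix_add_ldistrib matrix_scalar_ac T'Q scaleR_add_left
        flip: scalar_matrix_assoc)
  \<comment> \<open>As \<open>Q\<^sup>2 = A Q\<close>, an inverse of \<open>R\<close> can be sought among the combinations of \<open>I\<close> and \<open>Q\<close>: the
    coefficient of \<open>I\<close> must be \<open>1 / t\<close>, and \<open>\<beta>\<close> is the solution of the remaining linear equation.\<close>
  define \<beta> where "\<beta> = - s / (t * (s * A + t))"
  have "R ** ((1 / t) *\<^sub>R mat 1 + \<beta> *\<^sub>R Q) = mat 1 + (s / t + s * \<beta> * A + t * \<beta>) *\<^sub>R Q"
    unfolding R_def using assms(3)
    by (simp add: matrix_add_ldistrib matrix_add_rdistrib matrix_scalar_ac QQ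
        scaleR_add_left scaleR_add_right mult_ac flip: scalar_matrix_assoc)
  also have "s / t + s * \<beta> * A + t * \<beta> = 0"
  proof -
    have "s / t + s * \<beta> * A + t * \<beta> = s / t + \<beta> * (s * A + t)" by (simp add: algebra_simps)
    also have "\<dots> = 0" using pos assms(3) unfolding \<beta>_def by simp
    finally show ?thesis .
  qed
  finally have "\<exists>S. R ** S = mat 1" by auto
  then have "invertible R" by (simp add: invertible_right_inverse)
  then have RR: "R ** matrix_inv R = mat 1"
    unfolding invertible_def matrix_inv_def by (metis (mono_tags, lifting) someI_ex)
  have "s *\<^sub>R ?T' = \<alpha> *\<^sub>R (?T' ** R)" using pos by (simp add: T'R \<alpha>_def)
  then have "(s *\<^sub>R ?T') ** matrix_inv R = \<alpha> *\<^sub>R (?T' ** (R ** matrix_inv R))"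
    by (simp add: scalar_matrix_assoc matrix_mul_assoc)
  then show ?thesis unfolding RR matrix_mul_rid by (simp add: R_def Q_def \<alpha>_def)
qed

lemma tight_lmmse_filter:
  fixes W :: "'n::finite \<Rightarrow> (real^'m) set"
  assumes model: "signal_model Pr x n \<sigma>x \<sigma>n" and pos: "\<sigma>x\<^sup>2 > 0" "\<sigma>n\<^sup>2 > 0"
    and W: "\<And>i. subspace (W i)" and A: "A > 0" "(\<Sum>i\<in>UNIV. proj_matrix (W i)) = A *\<^sub>R mat 1"
  shows "lmmse_filter Pr x (measurement W x n) =
    (\<sigma>x\<^sup>2 / (\<sigma>x\<^sup>2 * A + \<sigma>n\<^sup>2)) *\<^sub>R
      Finite_Cartesian_Product.transpose (stack (\<lambda>i. proj_matrix (W i)))"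
proof -
  let ?T = "stack (\<lambda>i. proj_matrix (W i))"
  have z: "measurement W x n =
      (\<lambda>\<omega>. ?T *v x \<omega> + (\<Sum>i\<in>UNIV. stack (\<lambda>j. if j = i then mat 1 else 0) *v n i \<omega>))"
    by (rule ext) (rule measurement_eq_stack)
  have "corr_matrix Pr x (measurement W x n) = \<sigma>x\<^sup>2 *\<^sub>R Finite_Cartesian_Product.transpose ?T"
    using signal_model_corr_matrix[OF model, of "mat 1" "\<lambda>_. 0" ?T
        "\<lambda>i. stack (\<lambda>j. if j = i then mat 1 else 0)"] by (simp add: z)
  moreover have "corr_matrix Pr (measurement W x n) (measurement W x n) =
      \<sigma>x\<^sup>2 *\<^sub>R (?T ** Finite_Cartesian_Product.transpose ?T) + \<sigma>n\<^sup>2 *\<^sub>R mat 1"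
    unfolding z signal_model_corr_matrix[OF model] stacked_noise_covariance ..
  moreover have "Finite_Cartesian_Product.transpose ?T ** ?T = A *\<^sub>R mat 1"
    by (simp add: transpose_stack_mult_stack proj_matrix_symmetric proj_matrix_idempotent W A)
  ultimately show ?thesis
    using tight_lmmse_gain[OF _ pos A(1), of ?T] by (simp add: lmmse_filter_def)
qed


section \<open>The mean squared error under erasures\<close>

lemma erase_measurement_nth:
  "((mat 1 - erasure_matrix S) *v w) $ p = (if fst p \<in> S then 0 else w $ p)"
proof -
  have "((mat 1 - erasure_matrix S) *v w) $ p =
      (\<Sum>q\<in>UNIV. if q = p then if fst p \<in> S then 0 else w $ p else 0)"
    unfolding matrix_vector_mult_def vec_lambda_beta
    by (intro sum.cong) (auto simp: mat_def erasure_matrix_def)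
  then show ?thesis by simp
qed

lemma transpose_stack_erased_measurement:
  assumes W: "\<And>i. subspace (W i)"
  shows "Finite_Cartesian_Product.transpose (stack (\<lambda>i. proj_matrix (W i))) *v
      ((mat 1 - erasure_matrix S) *v measurement W x n \<omega>) =
    (\<Sum>i\<in>-S. proj_matrix (W i)) *v x \<omega> + (\<Sum>i\<in>-S. proj_matrix (W i) *v n i \<omega>)"
proof -
  have "(\<chi> k. ((mat 1 - erasure_matrix S) *v measurement W x n \<omega>) $ (i, k)) =
      (if i \<in> -S then proj_matrix (W i) *v x \<omega> + n i \<omega> else 0)" for i
    by (simp add: erase_measurement_nth measurement_def vec_eq_iff)
  then have "proj_matrix (W i) *v (\<chi> k. ((mat 1 - erasure_matrix S) *v measurement W x n \<omega>) $ (i, k)) =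
      (if i \<in> -S then proj_matrix (W i) *v x \<omega> + proj_matrix (W i) *v n i \<omega> else 0)" for i
    by (simp add: matrix_vector_right_distrib matrix_vector_mul_assoc proj_matrix_idempotent W)
  then show ?thesis
    unfolding transpose_stack_mult_vec proj_matrix_symmetric[OF W]
    by (simp add: sum.If_cases sum.distrib sum_mult_vec flip: Compl_eq)
qed

text \<open>
  The error is a linear image of signal and noise: \<open>B\<close> acts on the signal, and each surviving block
  contributes \<open>- \<alpha> P\<^sub>i n\<^sub>i\<close>. By tightness the sum of the surviving projections is \<open>A I\<close> minus the sum of
  the erased ones, which expresses \<open>B\<close> through the erased blocks alone.
\<close>
lemma erasure_mse_tight:
  fixes W :: "'n::finite \<Rightarrow> (real^'m) set"
  assumes model: "signal_model Pr x n \<sigma>x \<sigma>n" and pos: "\<sigma>x\<^sup>2 > 0" "\<sigma>n\<^sup>2 > 0"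
    and W: "\<And>i. subspace (W i)" and A: "A > 0" "(\<Sum>i\<in>UNIV. proj_matrix (W i)) = A *\<^sub>R mat 1"
    and \<alpha>: "\<alpha> = \<sigma>x\<^sup>2 / (\<sigma>x\<^sup>2 * A + \<sigma>n\<^sup>2)"
    and B: "B = (1 - \<alpha> * A) *\<^sub>R mat 1 + \<alpha> *\<^sub>R (\<Sum>i\<in>S. proj_matrix (W i))"
  shows "erasure_mse Pr W x n S = \<sigma>x\<^sup>2 * (B \<bullet> B) + \<sigma>n\<^sup>2 * \<alpha>\<^sup>2 * (\<Sum>i\<in>-S. real (dim (W i)))"
proof -
  define C where "C i = (if i \<in> -S then - \<alpha> *\<^sub>R proj_matrix (W i) else 0)" for i
  have "A *\<^sub>R mat 1 = (\<Sum>i\<in>-S. proj_matrix (W i)) + (\<Sum>i\<in>S. proj_matrix (W i))"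
    unfolding A(2)[symmetric] by (subst sum.union_disjoint[symmetric]) auto
  then have "(\<Sum>i\<in>-S. proj_matrix (W i)) = A *\<^sub>R mat 1 - (\<Sum>i\<in>S. proj_matrix (W i))" by simp
  then have B': "B = mat 1 - \<alpha> *\<^sub>R (\<Sum>i\<in>-S. proj_matrix (W i))"
    by (simp add: B scaleR_diff_left scaleR_diff_right)
  have "(\<Sum>i\<in>UNIV. C i *v n i \<omega>) = - \<alpha> *\<^sub>R (\<Sum>i\<in>-S. proj_matrix (W i) *v n i \<omega>)" for \<omega>
  proof -
    have "(\<Sum>i\<in>UNIV. C i *v n i \<omega>) = (\<Sum>i\<in>-S. C i *v n i \<omega>)"
      by (rule sum.mono_neutral_right) (auto simp: C_def)
    also have "\<dots> = (\<Sum>i\<in>-S. - \<alpha> *\<^sub>R (proj_matrix (W i) *v n i \<omega>))"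
      by (intro sum.cong) (auto simp: C_def scaleR_matrix_vector_assoc simp del: scaleR_minus_left)
    finally show ?thesis by (simp add: scaleR_sum_right)
  qed
  moreover have "B *v x \<omega> = x \<omega> - \<alpha> *\<^sub>R ((\<Sum>i\<in>-S. proj_matrix (W i)) *v x \<omega>)" for \<omega>
    by (simp add: B' matrix_vector_mult_diff_rdistrib scaleR_matrix_vector_assoc)
  ultimately have e: "x \<omega> - erasure_estimate Pr W x n S \<omega> = B *v x \<omega> + (\<Sum>i\<in>UNIV. C i *v n i \<omega>)" for \<omega>
    unfolding erasure_estimate_def tight_lmmse_filter[OF model pos W A] \<alpha>[symmetric]
      scaleR_matrix_vector_assoc[symmetric] transpose_stack_erased_measurement[OF W]
    by (simp add: scaleR_add_right)
  have "(\<Sum>i\<in>UNIV. C i \<bullet> C i) = (\<Sum>i\<in>-S. C i \<bullet> C i)"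
    by (rule sum.mono_neutral_right) (auto simp: C_def)
  also have "\<dots> = (\<Sum>i\<in>-S. \<alpha>\<^sup>2 * dim (W i))"
    by (intro sum.cong) (auto simp: C_def proj_matrix_inner_self W power2_eq_square)
  finally have CC: "(\<Sum>i\<in>UNIV. C i \<bullet> C i) = \<alpha>\<^sup>2 * (\<Sum>i\<in>-S. real (dim (W i)))"
    by (simp add: sum_distrib_left)
  have "erasure_mse Pr W x n S = \<sigma>x\<^sup>2 * (B \<bullet> B) + \<sigma>n\<^sup>2 * (\<Sum>i\<in>UNIV. C i \<bullet> C i)"
    unfolding erasure_mse_def Let_def e signal_model_corr_matrix[OF model]
    by (simp add: trace_eq_inner_mat_1 mult_transpose_inner_mat_1 inner_add_left inner_sum_left
        sum_distrib_left)
  then show ?thesis by (simp add: CC)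
qed

text \<open>
  The error for one erased pair as a function of the dimension \<open>M\<close>, the number \<open>N\<close> of subspaces, their
  dimension \<open>m\<close>, the variances \<open>s\<close> of the signal and \<open>t\<close> of the noise, and \<open>r = tr(P\<^sub>i P\<^sub>j)\<close>. The last
  argument is the only one through which two competing frames can differ.
\<close>
definition pair_mse :: "nat \<Rightarrow> nat \<Rightarrow> nat \<Rightarrow> real \<Rightarrow> real \<Rightarrow> real \<Rightarrow> real" where
  "pair_mse M N m s t r =
     (let A = real N * real m / real M; \<alpha> = s / (s * A + t)
      in s * ((1 - \<alpha> * A)\<^sup>2 * M + 4 * \<alpha> * (1 - \<alpha> * A) * m + 2 * \<alpha>\<^sup>2 * (m + r))
         + t * \<alpha>\<^sup>2 * ((real N - 2) * m))"

lemma pair_mse_mono: "0 \<le> s \<Longrightarrow> r \<le> r' \<Longrightarrow> pair_mse M N m s t r \<le> pair_mse M N m s t r'"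
  unfolding pair_mse_def Let_def by (intro add_mono mult_left_mono order_refl) auto

lemma inner_mat_1_self: "(mat 1 :: real^'m^'m) \<bullet> mat 1 = CARD('m)"
  unfolding trace_eq_inner_mat_1[symmetric] by (simp add: trace_def mat_def)

text \<open>
  Taking traces in \<open>\<Sum>P\<^sub>i = A I\<close> gives \<open>N m = A M\<close>.
\<close>
lemma tight_fusion_frame_bound:
  fixes W :: "'n::finite \<Rightarrow> (real^'m) set"
  assumes W: "\<And>i. subspace (W i)" "\<And>i. dim (W i) = m"
    and A: "(\<Sum>i\<in>UNIV. proj_matrix (W i)) = A *\<^sub>R mat 1"
  shows "A = real CARD('n) * m / real CARD('m)"
proof -
  have "(\<Sum>i\<in>UNIV. proj_matrix (W i)) \<bullet> mat 1 = real CARD('n) * m"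
    by (simp add: inner_sum_left proj_matrix_inner_mat_1 W)
  then show ?thesis by (simp add: A inner_mat_1_self field_simps)
qed

lemma erasure_mse_pair:
  fixes W :: "'n::finite \<Rightarrow> (real^'m) set"
  assumes model: "signal_model Pr x n \<sigma>x \<sigma>n" and pos: "\<sigma>x\<^sup>2 > 0" "\<sigma>n\<^sup>2 > 0"
    and tff: "tight_fusion_frame W" and dim: "\<And>i. dim (W i) = m" and "i \<noteq> j"
  shows "erasure_mse Pr W x n {i, j} =
    pair_mse CARD('m) CARD('n) m (\<sigma>x\<^sup>2) (\<sigma>n\<^sup>2) (proj_matrix (W i) \<bullet> proj_matrix (W j))"
proof -
  obtain A where A: "A > 0" "(\<Sum>i\<in>UNIV. proj_matrix (W i)) = A *\<^sub>R mat 1"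
    and W: "\<And>i. subspace (W i)"
    using tff by (auto simp: tight_fusion_frame_def)
  define \<alpha> where "\<alpha> = \<sigma>x\<^sup>2 / (\<sigma>x\<^sup>2 * A + \<sigma>n\<^sup>2)"
  let ?P = "proj_matrix (W i)" and ?Q = "proj_matrix (W j)"
  define B where "B = (1 - \<alpha> * A) *\<^sub>R mat 1 + \<alpha> *\<^sub>R (?P + ?Q)"
  have ip: "?P \<bullet> mat 1 = m" "?Q \<bullet> mat 1 = m" "mat 1 \<bullet> ?P = m" "mat 1 \<bullet> ?Q = m"
    "?P \<bullet> ?P = m" "?Q \<bullet> ?Q = m" "?Q \<bullet> ?P = ?P \<bullet> ?Q"
    by (simp_all add: proj_matrix_inner_mat_1 proj_matrix_inner_self W dim
        inner_commute[of "mat 1"] inner_commute[of ?Q ?P])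
  have BB: "B \<bullet> B = (1 - \<alpha> * A)\<^sup>2 * CARD('m) + 4 * \<alpha> * (1 - \<alpha> * A) * m + 2 * \<alpha>\<^sup>2 * (m + ?P \<bullet> ?Q)"
  proof -
    \<comment> \<open>The coefficient of the identity is kept opaque, so that the expansion does not multiply it out.\<close>
    obtain b where b: "1 - \<alpha> * A = b" by simp
    show ?thesis
      unfolding B_def b inner_add_left inner_add_right inner_scaleR_left inner_scaleR_right ip
        inner_mat_1_self
      by (simp add: power2_eq_square distrib_left)
  qed
  have "real (card (- {i, j})) = real CARD('n) - 2"
    using card_Un_disjoint[of "{i, j}" "- {i, j}"] \<open>i \<noteq> j\<close> by (simp del: Un_insert_left)
  then have dims: "(\<Sum>i\<in>-{i, j}. real (dim (W i))) = (real CARD('n) - 2) * m" by (simp add: dim)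
  have mse: "erasure_mse Pr W x n {i, j} =
      \<sigma>x\<^sup>2 * (B \<bullet> B) + \<sigma>n\<^sup>2 * \<alpha>\<^sup>2 * (\<Sum>i\<in>-{i, j}. real (dim (W i)))"
    by (rule erasure_mse_tight[OF model pos W A \<alpha>_def]) (simp add: B_def \<open>i \<noteq> j\<close>)
  show ?thesis
    unfolding mse BB dims
    unfolding pair_mse_def Let_def tight_fusion_frame_bound[OF W dim A(2), symmetric] \<alpha>_def ..
qed

section \<open>Averaging over pairs\<close>

text \<open>
  The squared norm of \<open>\<Sum>P\<^sub>i = A I\<close> is \<open>A\<^sup>2 M\<close> on one side and the sum of all \<open>tr(P\<^sub>i P\<^sub>j)\<close> on the other,
  where the diagonal terms contribute \<open>N m\<close>.
\<close>
lemma tight_fusion_frame_sum_off_diagonal: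
  fixes W :: "'n::finite \<Rightarrow> (real^'m) set"
  assumes tff: "tight_fusion_frame W" and dim: "\<And>i. dim (W i) = m"
  shows "(\<Sum>p | fst p \<noteq> snd p. proj_matrix (W (fst p)) \<bullet> proj_matrix (W (snd p))) =
    (real CARD('n) * m / real CARD('m))\<^sup>2 * CARD('m) - real CARD('n) * m"
proof -
  obtain A where A: "(\<Sum>i\<in>UNIV. proj_matrix (W i)) = A *\<^sub>R mat 1" and W: "\<And>i. subspace (W i)"
    using tff by (auto simp: tight_fusion_frame_def)
  let ?f = "\<lambda>p. proj_matrix (W (fst p)) \<bullet> proj_matrix (W (snd p))"
  have "(\<Sum>p | fst p = snd p. ?f p) = (\<Sum>p\<in>range (\<lambda>i. (i, i)). ?f p)"
    by (intro sum.cong) auto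
  also have "\<dots> = real CARD('n) * m"
    by (subst sum.reindex) (auto simp: inj_on_def proj_matrix_inner_self W dim)
  finally have diag: "(\<Sum>p | fst p = snd p. ?f p) = real CARD('n) * m" .
  have "(\<Sum>p | fst p = snd p. ?f p) + (\<Sum>p | fst p \<noteq> snd p. ?f p) = (\<Sum>p\<in>UNIV. ?f p)"
    by (subst sum.union_disjoint[symmetric]) (auto intro!: sum.cong)
  also have "\<dots> = (\<Sum>i\<in>UNIV. proj_matrix (W i)) \<bullet> (\<Sum>i\<in>UNIV. proj_matrix (W i))"
    unfolding inner_sum_left inner_sum_right sum_UNIV_Times fst_conv snd_conv by (rule sum.swap)
  also have "\<dots> = A\<^sup>2 * CARD('m)"
    by (simp add: A inner_mat_1_self power2_eq_square)
  finally show ?thesis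
    using diag tight_fusion_frame_bound[OF W dim A] by simp
qed

lemma equidistance_inner_const:
  fixes W :: "'n::finite \<Rightarrow> (real^'m) set"
  assumes "equidistance_tight_fusion_frame W"
  shows "\<exists>c. \<forall>i j. i \<noteq> j \<longrightarrow> proj_matrix (W i) \<bullet> proj_matrix (W j) = c"
proof -
  obtain m d where W: "\<And>i. subspace (W i)" "\<And>i. dim (W i) = m"
    and d: "\<And>i j. i \<noteq> j \<Longrightarrow> chordal_dist (W i) (W j) = d"
    using assms by (auto simp: equidistance_tight_fusion_frame_def tight_fusion_frame_def)
  have d': "sqrt (m - proj_matrix (W i) \<bullet> proj_matrix (W j)) = d" if "i \<noteq> j" for i j
    using d[OF that] chordal_dist_eq[of "W i" "W j"] W by simp
  have const: "proj_matrix (W i) \<bullet> proj_matrix (W j) = proj_matrix (W k) \<bullet> proj_matrix (W l)"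
    if "i \<noteq> j" "k \<noteq> l" for i j k l
  proof -
    have "sqrt (m - proj_matrix (W i) \<bullet> proj_matrix (W j)) =
        sqrt (m - proj_matrix (W k) \<bullet> proj_matrix (W l))"
      unfolding d'[OF that(1)] d'[OF that(2)] ..
    then show ?thesis by simp
  qed
  show ?thesis
  proof (cases "\<exists>k l :: 'n. k \<noteq> l")
    case True
    then obtain k l :: 'n where "k \<noteq> l" by blast
    show ?thesis
      by (intro exI[of _ "proj_matrix (W k) \<bullet> proj_matrix (W l)"] allI impI)
        (rule const[OF _ \<open>k \<noteq> l\<close>])
  qed auto
qed

theorem theorem3p2:
  fixes Pr :: "'a measure"
    and x :: "'a \<Rightarrow> real^'m" and n :: "'n::finite \<Rightarrow> 'a \<Rightarrow> real^'m"
    and W Wstar :: "'n \<Rightarrow> (real^'m) set"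
    and \<sigma>x \<sigma>n :: real and m :: nat
  assumes "2 \<le> CARD('n)" and "1 \<le> m" and "m \<le> CARD('m)"
    and "\<sigma>x\<^sup>2 > 0" and "\<sigma>n\<^sup>2 > 0"
    and "signal_model Pr x n \<sigma>x \<sigma>n"
    and "equidistance_tight_fusion_frame Wstar" and "\<And>i. dim (Wstar i) = m"
    and "tight_fusion_frame W" and "\<And>i. dim (W i) = m"
  shows "two_erasure_mse Pr Wstar x n \<le> two_erasure_mse Pr W x n"
proof -
  let ?D = "{p :: 'n \<times> 'n. fst p \<noteq> snd p}"
  let ?g = "\<lambda>W p. proj_matrix (W (fst p)) \<bullet> proj_matrix (W (snd p) :: (real^'m) set)"
  let ?h = "pair_mse CARD('m) CARD('n) m (\<sigma>x\<^sup>2) (\<sigma>n\<^sup>2)"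
  have tff: "tight_fusion_frame Wstar"
    using assms(7) by (simp add: equidistance_tight_fusion_frame_def)
  have D: "?D \<noteq> {}"
  proof -
    have "\<not> is_singleton (UNIV :: 'n set)" using assms(1) by (auto simp: is_singleton_altdef)
    then obtain i j :: 'n where "i \<noteq> j"
      by (metis UNIV_I UNIV_eq_I is_singletonI insertCI singletonD)
    then show ?thesis by auto
  qed
  have mse: "two_erasure_mse Pr V x n = Max ((\<lambda>p. ?h (?g V p)) ` ?D)"
    if "tight_fusion_frame V" "\<And>i. dim (V i) = m" for V
  proof -
    have "{erasure_mse Pr V x n {i, j} |i j. i \<noteq> j} = (\<lambda>p. erasure_mse Pr V x n {fst p, snd p}) ` ?D"
      by (auto simp: image_iff) blast
    also have "\<dots> = (\<lambda>p. ?h (?g V p)) ` ?D"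
      by (intro image_cong refl) (auto intro!: erasure_mse_pair assms that)
    finally show ?thesis by (simp add: two_erasure_mse_def)
  qed
  obtain c where c: "\<And>i j. i \<noteq> j \<Longrightarrow> proj_matrix (Wstar i) \<bullet> proj_matrix (Wstar j) = c"
    using equidistance_inner_const[OF assms(7)] by blast
  \<comment> \<open>Both frames have the same total over \<open>?D\<close>, so some pair of \<open>W\<close> reaches the common value \<open>c\<close>.\<close>
  have "\<exists>p\<in>?D. c \<le> ?g W p"
  proof (rule ccontr)
    assume "\<not> (\<exists>p\<in>?D. c \<le> ?g W p)"
    then have "(\<Sum>p\<in>?D. ?g W p) < (\<Sum>p\<in>?D. ?g Wstar p)"
      using D c by (intro sum_strict_mono) (auto simp: not_le)
    then show False
      unfolding tight_fusion_frame_sum_off_diagonal[OF tff assms(8)]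
        tight_fusion_frame_sum_off_diagonal[OF assms(9,10)] by simp
  qed
  then obtain p where p: "p \<in> ?D" "c \<le> ?g W p" by blast
  have "(\<lambda>p. ?h (?g Wstar p)) ` ?D = {?h c}"
    using D c by (auto simp: image_def)
  then have "two_erasure_mse Pr Wstar x n = ?h c" by (simp add: mse[OF tff assms(8)])
  also have "\<dots> \<le> ?h (?g W p)" using assms(4) p(2) by (intro pair_mse_mono) auto
  also have "\<dots> \<le> two_erasure_mse Pr W x n"
    unfolding mse[OF assms(9,10)] using p(1) by (intro Max_ge) auto
  finally show ?thesis .
qed

end
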